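(* Let $\sigma\in\mathcal S_{0,\infty}$ be given and let the growth condition (defined in the context) hold for $\sigma$. Suppose that for some $p\ge1$ and $b>0$ $$\int_s^\infty\|U_\sigma(t,s)x\|^p\,dt+\sum_{k\ge1,\ t_k>s}\|U_\sigma(t_k^-,s)x\|^p\le b^p\|x\|^p$$ holds for all $s\ge0$ and all $x\in X$. Then there exist constants $M\ge1$, $\alpha>0$ and $\rho\in(0,1)$ such that $$\|U_\sigma(t,s)x\|\le Me^{-\alpha(t-s)}\rho^{\kappa_\sigma(t,s)}\|x\|$$ for all $t\ge s\ge0$ and all $x\in X$.
   Context: Setting. $X$ is a Banach space with norm $\|\cdot\|$; $A:D(A)\subset X\to X$ generates a strongly continuous ($C_0$) semigroup $(S(t))_{t\ge0}$ on $X$; $J\in L(X)$ is bounded, $J\neq0$, $JD(A)\subset D(A)$. $\mathcal S_{0,\infty}$ is the set of sequences $\sigma=\{t_k\}_{k\ge1}$ with, setting $t_0:=0$, $t_{k+1}>t_k$ for all $k\ge0$ and $t_k\to\infty$; $\mathbb T_\sigma:=\{t_k:k\ge1\}$. The impulsive system is $\dot x(t)=Ax(t)$ for $t\notin\mathbb T_\sigma$, $x(t)=Jx(t^-)$ for $t\in\mathbb T_\sigma$. Its propagator $U_\sigma(t,s)$, $t\ge s\ge0$, is: $U_\sigma(t,s)=S(t-s)$ if $(s,t]\cap\mathbb T_\sigma=\varnothing$; otherwise, if $t_l<\dots<t_m$ are the impulse times in $(s,t]$, $U_\sigma(t,s)=S(t-t_m)JS(t_m-t_{m-1})J\cdots JS(t_l-s)$.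 For $s<t_k$, $U_\sigma(t_k^-,s)x:=\lim_{t\uparrow t_k}U_\sigma(t,s)x$. $\kappa_\sigma(t,s):=\#(\mathbb T_\sigma\cap(s,t])$. Growth condition for $\sigma$: there exist a piecewise continuous $g:\mathbb R_{\ge0}\to\mathbb R_{>0}$ bounded below by some $c_0>0$, and $\mu>1$, such that $\|U_\sigma(t,s)x\|\le g(t-s)\mu^{\kappa_\sigma(t,s)}\|x\|$ for all $t\ge s\ge0$, $x\in X$, and $G:=\sup_{0\le\tau<\bar T}g(\tau)<\infty$, where $\bar T:=\sup_{k\ge0}(t_{k+1}-t_k)\in(0,\infty]$. *)

theory Defs
  imports "HOL-Analysis.Analysis"
begin

definition C0_semigroup :: "(real \<Rightarrow> 'a::banach \<Rightarrow>\<^sub>L 'a) \<Rightarrow> bool" where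
  "C0_semigroup S \<longleftrightarrow>
     S 0 = id_blinfun \<and>
     (\<forall>t\<ge>0. \<forall>s\<ge>0. S (t + s) = S t o\<^sub>L S s) \<and>
     (\<forall>x. ((\<lambda>t. blinfun_apply (S t) x) \<longlongrightarrow> x) (at_right 0))"

text \<open>An unbounded operator is given by its domain \<open>D\<close> together with a function \<open>A\<close> whose
  values outside \<open>D\<close> are irrelevant.\<close>

definition generates_C0 :: "'a set \<Rightarrow> ('a \<Rightarrow> 'a) \<Rightarrow> (real \<Rightarrow> 'a::banach \<Rightarrow>\<^sub>L 'a) \<Rightarrow> bool" where
  "generates_C0 D A S \<longleftrightarrow>
     C0_semigroup S \<and>
     D = {x. \<exists>y. ((\<lambda>h. (blinfun_apply (S h) x - x) /\<^sub>R h) \<longlongrightarrow> y) (at_right 0)} \<and>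
     (\<forall>x\<in>D. ((\<lambda>h. (blinfun_apply (S h) x - x) /\<^sub>R h) \<longlongrightarrow> A x) (at_right 0))"

text \<open>The impulse times are \<open>\<sigma> 1 < \<sigma> 2 < \<dots>\<close>. The value \<open>\<sigma> 0 = 0\<close> only encodes the
  convention \<open>t\<^sub>0 = 0\<close>; it is not an impulse time.\<close>

definition impulse_sequence :: "(nat \<Rightarrow> real) \<Rightarrow> bool" where
  "impulse_sequence \<sigma> \<longleftrightarrow>
     \<sigma> 0 = 0 \<and> (\<forall>k. \<sigma> k < \<sigma> (Suc k)) \<and> filterlim \<sigma> at_top sequentially"

definition impulse_times :: "(nat \<Rightarrow> real) \<Rightarrow> real set" where
  "impulse_times \<sigma> = \<sigma> ` {1..}"

definition impulse_count :: "(nat \<Rightarrow> real) \<Rightarrow> real \<Rightarrow> real \<Rightarrow> nat" where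
  "impulse_count \<sigma> t s = card (impulse_times \<sigma> \<inter> {s<..t})"

text \<open>\<open>flow_through S J [r\<^sub>1, \<dots>, r\<^sub>n] s t\<close> is
  \<open>S (t - r\<^sub>n) J S (r\<^sub>n - r\<^sub>n\<^sub>-\<^sub>1) J \<dots> J S (r\<^sub>1 - s)\<close>.\<close>

fun flow_through ::
  "(real \<Rightarrow> 'a::banach \<Rightarrow>\<^sub>L 'a) \<Rightarrow> ('a \<Rightarrow>\<^sub>L 'a) \<Rightarrow> real list \<Rightarrow> real \<Rightarrow> real \<Rightarrow> 'a \<Rightarrow>\<^sub>L 'a" where
  "flow_through S J [] s t = S (t - s)"
| "flow_through S J (r # rs) s t = flow_through S J rs r t o\<^sub>L J o\<^sub>L S (r - s)"

definition propagator ::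
  "(real \<Rightarrow> 'a::banach \<Rightarrow>\<^sub>L 'a) \<Rightarrow> ('a \<Rightarrow>\<^sub>L 'a) \<Rightarrow> (nat \<Rightarrow> real) \<Rightarrow> real \<Rightarrow> real \<Rightarrow> 'a \<Rightarrow>\<^sub>L 'a" where
  "propagator S J \<sigma> t s =
     flow_through S J (sorted_list_of_set (impulse_times \<sigma> \<inter> {s<..t})) s t"

text \<open>\<open>U\<^sub>\<sigma>(t\<^sup>-, s) x\<close>\<close>

definition propagator_left ::
  "(real \<Rightarrow> 'a::banach \<Rightarrow>\<^sub>L 'a) \<Rightarrow> ('a \<Rightarrow>\<^sub>L 'a) \<Rightarrow> (nat \<Rightarrow> real) \<Rightarrow> real \<Rightarrow> real \<Rightarrow> 'a \<Rightarrow> 'a" where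
  "propagator_left S J \<sigma> t s x = Lim (at_left t) (\<lambda>r. blinfun_apply (propagator S J \<sigma> r s) x)"

definition max_dwell_time :: "(nat \<Rightarrow> real) \<Rightarrow> ereal" where
  "max_dwell_time \<sigma> = (SUP k. ereal (\<sigma> (Suc k) - \<sigma> k))"

text \<open>Finitely many discontinuities in each bounded interval, and finite one-sided limits
  everywhere on \<open>{0..}\<close>.\<close>

definition piecewise_continuous_nonneg :: "(real \<Rightarrow> real) \<Rightarrow> bool" where
  "piecewise_continuous_nonneg g \<longleftrightarrow>
     (\<exists>E. (\<forall>T. finite (E \<inter> {0..T})) \<and>
          (\<forall>\<tau>\<in>{0..} - E. continuous (at \<tau> within {0..}) g)) \<and>
     (\<forall>\<tau>\<ge>0. \<exists>l. (g \<longlongrightarrow> l) (at_right \<tau>)) \<and>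
     (\<forall>\<tau>>0. \<exists>l. (g \<longlongrightarrow> l) (at_left \<tau>))"

definition growth_condition ::
  "(real \<Rightarrow> 'a::banach \<Rightarrow>\<^sub>L 'a) \<Rightarrow> ('a \<Rightarrow>\<^sub>L 'a) \<Rightarrow> (nat \<Rightarrow> real) \<Rightarrow> bool" where
  "growth_condition S J \<sigma> \<longleftrightarrow>
     (\<exists>(g :: real \<Rightarrow> real) (\<mu> :: real).
        piecewise_continuous_nonneg g \<and>
        (\<forall>\<tau>\<ge>0. 0 < g \<tau>) \<and>
        (\<exists>c0>0. \<forall>\<tau>\<ge>0. c0 \<le> g \<tau>) \<and>
        1 < \<mu> \<and>
        (\<forall>s\<ge>0. \<forall>t\<ge>s. \<forall>x.
           norm (blinfun_apply (propagator S J \<sigma> t s) x)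
             \<le> g (t - s) * \<mu> ^ impulse_count \<sigma> t s * norm x) \<and>
        (SUP \<tau>\<in>{\<tau>. 0 \<le> \<tau> \<and> ereal \<tau> < max_dwell_time \<sigma>}. ereal (g \<tau>)) < \<infinity>)"

end

theory Submission
  imports Defs
begin

text \<open>The argument is Datko's: a uniformly bounded evolution family whose orbits are uniformly
  \<open>p\<close>-summable decays exponentially. It is run twice, with two clocks that measure progress along an
  orbit of \<open>U = U\<^sub>\<sigma>\<close>: the time \<open>t\<close>, and the number \<open>i(t)\<close> of impulses up to \<open>t\<close>.

  Uniform boundedness comes first. Between two consecutive impulses the elapsed time stays below the
  maximal dwell time, so there the growth condition bounds the semigroup by a constant \<open>G\<close>.
  Each single term of the sum in the hypothesis gives \<open>\<parallel>U(t\<^sub>k\<^sup>-, s)x\<parallel> \<le> b\<parallel>x\<parallel>\<close>, however many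
  impulses lie in between. Writing \<open>U(t, s)x = S(t - t\<^sub>m) J U(t\<^sub>m\<^sup>-, s)x\<close> with the last impulse time
  \<open>t\<^sub>m \<le> t\<close> yields \<open>\<parallel>U(t, s)\<parallel> \<le> C\<close> with \<open>C = G max(1, b\<parallel>J\<parallel>)\<close>.

  Consequently \<open>\<parallel>U(t, s)x\<parallel> / C\<close> is a lower bound for \<open>\<parallel>U(r, s)x\<parallel>\<close> at every \<open>r\<close> in \<open>[s, t]\<close>.
  Integrating the \<open>p\<close>-th powers over \<open>[s, t]\<close>, or summing them over the impulse times in \<open>(s, t]\<close>,
  turns the hypothesis into \<open>(\<phi> t - \<phi> s) (\<parallel>U(t, s)x\<parallel> / C)\<^sup>p \<le> (B\<parallel>x\<parallel>)\<^sup>p\<close> for either clock \<open>\<phi>\<close>.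
  Hence \<open>U\<close> halves norms whenever the clock advances far enough, and iterating this gives
  exponential decay in the clock (lemma \<open>exponential_decay_in_clock\<close>).

  The two estimates are combined by \<open>min (exp (-u)) (exp (-v)) \<le> exp (-(u + v)/2)\<close>.\<close>

section \<open>Indexing of the impulse times\<close>

text \<open>The number of impulse times in \<open>(0, t]\<close>, or the index of the last one of them. Taking the
  least \<open>k\<close> with \<open>t < \<sigma> (Suc k)\<close> gives the value \<open>0\<close> before the first impulse, in line with
  \<open>\<sigma> 0 = 0\<close>. The number of impulses in \<open>(s, t]\<close> becomes a difference of indices, which makes it a
  clock that adds up along consecutive intervals.\<close>

definition impulse_index :: "(nat \<Rightarrow> real) \<Rightarrow> real \<Rightarrow> nat" where
  "impulse_index \<sigma> t = (LEAST k. t < \<sigma> (Suc k))"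

lemma impulse_sequence_strict_mono: "impulse_sequence \<sigma> \<Longrightarrow> strict_mono \<sigma>"
  by (simp add: impulse_sequence_def strict_mono_Suc_iff)

lemma impulse_sequence_nonneg: "impulse_sequence \<sigma> \<Longrightarrow> 0 \<le> \<sigma> k"
  using strict_mono_less_eq[OF impulse_sequence_strict_mono, of \<sigma> 0 k]
  by (simp add: impulse_sequence_def)

lemma impulse_index_brackets:
  assumes "impulse_sequence \<sigma>" "0 \<le> t"
  shows "\<sigma> (impulse_index \<sigma> t) \<le> t" "t < \<sigma> (Suc (impulse_index \<sigma> t))"
proof -
  have "\<forall>\<^sub>F k in sequentially. t < \<sigma> k"
    using assms(1) by (auto simp: impulse_sequence_def filterlim_at_top_dense)
  then obtain n where "t < \<sigma> (Suc n)"
    by (metis eventually_sequentially le_SucI order_refl)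
  then show less: "t < \<sigma> (Suc (impulse_index \<sigma> t))"
    unfolding impulse_index_def by (rule LeastI)
  show "\<sigma> (impulse_index \<sigma> t) \<le> t"
  proof (cases "impulse_index \<sigma> t")
    case 0
    then show ?thesis using assms by (simp add: impulse_sequence_def)
  next
    case (Suc j)
    then have "\<not> t < \<sigma> (Suc j)"
      using not_less_Least[of j "\<lambda>k. t < \<sigma> (Suc k)"] by (simp add: impulse_index_def)
    then show ?thesis using Suc by simp
  qed
qed

text \<open>Comparisons of times with impulse times become comparisons of natural numbers: \<open>impulse_index \<sigma>\<close>
  is the upper adjoint of \<open>\<sigma>\<close> on the nonnegative times.\<close>

lemma le_impulse_index_iff:
  assumes "impulse_sequence \<sigma>" "0 \<le> t"
  shows "k \<le> impulse_index \<sigma> t \<longleftrightarrow> \<sigma> k \<le> t"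
proof -
  note m = impulse_sequence_strict_mono[OF assms(1)]
  have "\<sigma> k \<le> \<sigma> (impulse_index \<sigma> t)" if "k \<le> impulse_index \<sigma> t"
    using that by (simp add: strict_mono_less_eq[OF m])
  moreover have "\<sigma> (Suc (impulse_index \<sigma> t)) \<le> \<sigma> k" if "\<not> k \<le> impulse_index \<sigma> t"
    using that by (simp add: strict_mono_less_eq[OF m])
  ultimately show ?thesis
    using impulse_index_brackets[OF assms] by force
qed

lemma impulse_index_eqI:
  assumes "impulse_sequence \<sigma>" "\<sigma> k \<le> t" "t < \<sigma> (Suc k)"
  shows "impulse_index \<sigma> t = k"
proof -
  have "0 \<le> t" using impulse_sequence_nonneg[OF assms(1), of k] assms(2) by simp
  then show ?thesis
    using le_impulse_index_iff[OF assms(1), of t k] le_impulse_index_iff[OF assms(1), of t "Suc k"]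
      assms(2,3) by auto
qed

lemma impulse_index_impulse_time: "impulse_sequence \<sigma> \<Longrightarrow> impulse_index \<sigma> (\<sigma> k) = k"
  by (rule impulse_index_eqI) (auto simp: impulse_sequence_def)

lemma impulse_index_mono:
  assumes "impulse_sequence \<sigma>" "0 \<le> s" "s \<le> t"
  shows "impulse_index \<sigma> s \<le> impulse_index \<sigma> t"
  using assms impulse_index_brackets(1)[of \<sigma> s] by (simp add: le_impulse_index_iff)

lemma impulse_times_between:
  assumes "impulse_sequence \<sigma>" "0 \<le> s" "s \<le> t"
  shows "impulse_times \<sigma> \<inter> {s<..t} = \<sigma> ` {impulse_index \<sigma> s<..impulse_index \<sigma> t}"
proof -
  have "s < \<sigma> k \<longleftrightarrow> impulse_index \<sigma> s < k" "\<sigma> k \<le> t \<longleftrightarrow> k \<le> impulse_index \<sigma> t" for k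
    using le_impulse_index_iff[OF assms(1,2), of k] le_impulse_index_iff[OF assms(1), of t k] assms
    by auto
  then show ?thesis by (auto simp: impulse_times_def)
qed

lemma impulse_count_eq:
  assumes "impulse_sequence \<sigma>" "0 \<le> s" "s \<le> t"
  shows "impulse_count \<sigma> t s = impulse_index \<sigma> t - impulse_index \<sigma> s"
  unfolding impulse_count_def impulse_times_between[OF assms]
  using strict_mono_imp_inj_on[OF impulse_sequence_strict_mono[OF assms(1)]]
  by (simp add: card_image inj_on_subset[of _ UNIV])

section \<open>The propagator as an evolution family\<close>

lemma propagator_eq:
  assumes "impulse_sequence \<sigma>" "0 \<le> s" "s \<le> t"
  shows "propagator S J \<sigma> t s =
    flow_through S J (map \<sigma> [Suc (impulse_index \<sigma> s)..<Suc (impulse_index \<sigma> t)]) s t"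
proof -
  have "sorted_wrt (<) (map \<sigma> [m..<n])" for m n
    using strict_mono_less[OF impulse_sequence_strict_mono[OF assms(1)]]
    by (simp add: sorted_wrt_map)
  then have "sorted_list_of_set (set (map \<sigma> [m..<n])) = map \<sigma> [m..<n]" for m n
    by (rule sorted_list_of_set.idem_if_sorted_distinct[OF strict_sorted_imp_sorted])
       (simp add: distinct_map strict_mono_imp_inj_on[OF impulse_sequence_strict_mono[OF assms(1)]])
  from this[of "Suc (impulse_index \<sigma> s)" "Suc (impulse_index \<sigma> t)"] show ?thesis
    unfolding propagator_def impulse_times_between[OF assms]
    by (simp del: upt_Suc add: atLeastSucLessThan_greaterThanLessThan atLeastLessThanSuc_atLeastAtMost
        atLeastSucAtMost_greaterThanAtMost)
qed

lemma C0_semigroup_add: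
  "C0_semigroup S \<Longrightarrow> 0 \<le> s \<Longrightarrow> 0 \<le> t \<Longrightarrow> S (t + s) = S t o\<^sub>L S s"
  by (simp add: C0_semigroup_def)

lemma blinfun_compose_assoc: "(f o\<^sub>L g) o\<^sub>L h = f o\<^sub>L (g o\<^sub>L h)"
  by (rule blinfun_eqI) simp

text \<open>The semigroup factor that follows the last jump in \<open>xs\<close> has \<open>r\<close> in its time span; the semigroup
  law splits it at \<open>r\<close>, and the other factors are the same on both sides.\<close>

lemma flow_through_append:
  assumes "C0_semigroup S"
  shows "\<lbrakk>s \<le> r; r \<le> t; \<forall>u\<in>set xs. u \<le> r; \<forall>u\<in>set ys. r \<le> u; sorted (s # xs)\<rbrakk> \<Longrightarrow>
    flow_through S J (xs @ ys) s t = flow_through S J ys r t o\<^sub>L flow_through S J xs s r"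
proof (induction xs arbitrary: s)
  case Nil
  have split: "S (v - s) = S (v - r) o\<^sub>L S (r - s)" if "r \<le> v" for v
    using C0_semigroup_add[OF assms, of "r - s" "v - r"] that Nil.prems by simp
  show ?case
  proof (cases ys)
    case Nil
    then show ?thesis using split[of t] \<open>r \<le> t\<close> by simp
  next
    case (Cons v vs)
    then show ?thesis using split[of v] Nil.prems by (simp add: blinfun_compose_assoc)
  qed
next
  case (Cons x xs)
  then show ?case by (simp add: blinfun_compose_assoc)
qed

text \<open>If \<open>r\<close> is an impulse time, its jump belongs to the factor \<open>U(r, s)\<close>, because the propagator
  collects the impulses of the half-open interval \<open>(s, r]\<close>.\<close>

lemma propagator_compose:
  assumes "C0_semigroup S" "impulse_sequence \<sigma>" "0 \<le> s" "s \<le> r" "r \<le> t"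
  shows "propagator S J \<sigma> t s = propagator S J \<sigma> t r o\<^sub>L propagator S J \<sigma> r s"
proof -
  let ?i = "impulse_index \<sigma>"
  have le: "?i s \<le> ?i r" "?i r \<le> ?i t"
    using assms by (auto intro: impulse_index_mono)
  have "s < \<sigma> k" if "?i s < k" for k
    using le_impulse_index_iff[OF assms(2,3), of k] that by auto
  moreover have "\<sigma> k \<le> r" if "k \<le> ?i r" for k
    using le_impulse_index_iff[OF assms(2), of r k] assms that by auto
  moreover have "r < \<sigma> k" if "?i r < k" for k
    using le_impulse_index_iff[OF assms(2), of r k] assms that by auto
  moreover have "sorted (map \<sigma> [m..<n])" for m n
    using strict_mono_less_eq[OF impulse_sequence_strict_mono[OF assms(2)]]
    by (simp add: sorted_wrt_map)
  moreover have "[Suc (?i s)..<Suc (?i t)] =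
      [Suc (?i s)..<Suc (?i r)] @ [Suc (?i r)..<Suc (?i t)]"
    using le upt_add_eq_append[of "Suc (?i s)" "Suc (?i r)" "?i t - ?i r"] by simp
  ultimately show ?thesis
    using assms
    by (simp add: propagator_eq less_imp_le Suc_le_eq flow_through_append[where r=r] del: upt_Suc)
qed

lemma propagator_between_impulses:
  assumes "impulse_sequence \<sigma>" "\<sigma> k \<le> s" "s \<le> t" "t < \<sigma> (Suc k)"
  shows "propagator S J \<sigma> t s = S (t - s)"
proof -
  have "0 \<le> s" using impulse_sequence_nonneg[OF assms(1), of k] assms(2) by simp
  then show ?thesis
    using assms by (simp add: propagator_eq impulse_index_eqI[of \<sigma> k])
qed

lemma propagator_at_impulse:
  assumes "C0_semigroup S" "impulse_sequence \<sigma>" "\<sigma> k \<le> s" "s < \<sigma> (Suc k)"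
  shows "propagator S J \<sigma> (\<sigma> (Suc k)) s = J o\<^sub>L S (\<sigma> (Suc k) - s)"
proof -
  have "0 \<le> s" using impulse_sequence_nonneg[OF assms(2), of k] assms(3) by simp
  moreover have "S 0 o\<^sub>L J = J"
    using assms(1) by (auto simp: C0_semigroup_def intro: blinfun_eqI)
  ultimately show ?thesis
    using assms
    by (simp add: propagator_eq impulse_index_eqI[of \<sigma> k] impulse_index_impulse_time
        flip: blinfun_compose_assoc)
qed

text \<open>Strong continuity is given at \<open>0\<close> from the right only. Left continuity follows from
  \<open>S t x - S u x = S u (S (t - u) x - x)\<close> and a bound on \<open>S u\<close> that is uniform in \<open>u < t\<close>.\<close>

lemma C0_semigroup_left_continuous:
  assumes "C0_semigroup S" "0 < t"
    and bound: "\<And>u. 0 \<le> u \<Longrightarrow> u < t \<Longrightarrow> norm (S u) \<le> G"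
  shows "((\<lambda>u. blinfun_apply (S u) x) \<longlongrightarrow> blinfun_apply (S t) x) (at_left t)"
proof -
  have "filterlim (\<lambda>u. t - u) (at_right 0) (at_left t)"
    unfolding filterlim_at
    by (auto intro!: tendsto_eq_intros simp: eventually_at_filter)
  then have "((\<lambda>u. blinfun_apply (S (t - u)) x) \<longlongrightarrow> x) (at_left t)"
    by (rule filterlim_compose[rotated]) (use assms(1) in \<open>simp add: C0_semigroup_def\<close>)
  then have lim: "((\<lambda>u. G * norm (blinfun_apply (S (t - u)) x - x)) \<longlongrightarrow> 0) (at_left t)"
    using tendsto_mult[OF tendsto_const[of G] tendsto_norm_zero[OF LIM_zero]] by fastforce
  have "\<forall>\<^sub>F u in at_left t.
      norm (blinfun_apply (S u) x - blinfun_apply (S t) x)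
        \<le> G * norm (blinfun_apply (S (t - u)) x - x)"
    using eventually_at_left_real[OF assms(2)]
  proof eventually_elim
    case (elim u)
    then have "S t = S u o\<^sub>L S (t - u)"
      using C0_semigroup_add[OF assms(1), of "t - u" u] by simp
    then have "blinfun_apply (S u) x - blinfun_apply (S t) x =
        - blinfun_apply (S u) (blinfun_apply (S (t - u)) x - x)"
      by (simp add: blinfun.diff_right)
    also have "norm \<dots> \<le> norm (S u) * norm (blinfun_apply (S (t - u)) x - x)"
      by (simp add: norm_blinfun)
    also have "\<dots> \<le> G * norm (blinfun_apply (S (t - u)) x - x)"
      using elim bound by (intro mult_right_mono) auto
    finally show ?case .
  qed
  then have "((\<lambda>u. blinfun_apply (S u) x - blinfun_apply (S t) x) \<longlongrightarrow> 0) (at_left t)"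
    using lim by (rule Lim_null_comparison)
  then show ?thesis by (rule LIM_zero_cancel)
qed

text \<open>The summability hypothesis speaks about left limits, whereas decay concerns the propagator itself.
  Just before \<open>\<sigma> k\<close> the orbit follows the semigroup from \<open>max s (\<sigma> (k - 1))\<close> on, so the left limit
  exists by left continuity of the semigroup and \<open>J\<close> maps it to the state at \<open>\<sigma> k\<close>.\<close>

lemma propagator_impulse_eq_jump_of_left_limit:
  assumes "C0_semigroup S" "impulse_sequence \<sigma>" "0 \<le> s" "s < \<sigma> k"
    and bound: "\<And>k u. 0 \<le> u \<Longrightarrow> u < \<sigma> (Suc k) - \<sigma> k \<Longrightarrow> norm (S u) \<le> G"
  shows "blinfun_apply (propagator S J \<sigma> (\<sigma> k) s) x =
    blinfun_apply J (propagator_left S J \<sigma> (\<sigma> k) s x)"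
proof -
  obtain j where k: "k = Suc j"
    using assms(2-4) by (cases k) (auto simp: impulse_sequence_def)
  define r where "r = max s (\<sigma> j)"
  define y where "y = blinfun_apply (propagator S J \<sigma> r s) x"
  have r: "0 \<le> r" "s \<le> r" "\<sigma> j \<le> r" "r < \<sigma> k"
    using assms(2-4) by (auto simp: r_def k impulse_sequence_def)
  have "((\<lambda>u. blinfun_apply (S u) y) \<longlongrightarrow> blinfun_apply (S (\<sigma> k - r)) y) (at_left (\<sigma> k - r))"
    using r by (intro C0_semigroup_left_continuous[OF assms(1), of _ G] bound[of _ j])
      (auto simp: k)
  moreover have "filterlim (\<lambda>u. u - r) (at_left (\<sigma> k - r)) (at_left (\<sigma> k))"
    unfolding filterlim_at
    by (auto intro!: tendsto_eq_intros simp: eventually_at_filter)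
  ultimately have
    "((\<lambda>u. blinfun_apply (S (u - r)) y) \<longlongrightarrow> blinfun_apply (S (\<sigma> k - r)) y) (at_left (\<sigma> k))"
    by (rule filterlim_compose)
  moreover have "\<forall>\<^sub>F u in at_left (\<sigma> k).
      blinfun_apply (S (u - r)) y = blinfun_apply (propagator S J \<sigma> u s) x"
    using eventually_at_left_real[OF r(4)]
  proof eventually_elim
    case (elim u)
    then show ?case
      using r propagator_compose[OF assms(1-3) r(2), of u J]
        propagator_between_impulses[OF assms(2) r(3), of u S J]
      by (simp add: k y_def)
  qed
  ultimately have
    "((\<lambda>u. blinfun_apply (propagator S J \<sigma> u s) x) \<longlongrightarrow> blinfun_apply (S (\<sigma> k - r)) y) (at_left (\<sigma> k))"
    by (rule Lim_transform_eventually)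
  then have "propagator_left S J \<sigma> (\<sigma> k) s x = blinfun_apply (S (\<sigma> k - r)) y"
    unfolding propagator_left_def by (intro tendsto_Lim) auto
  then show ?thesis
    using propagator_compose[OF assms(1-3) r(2), of "\<sigma> k" J] r
      propagator_at_impulse[OF assms(1,2) r(3), of J]
    by (simp add: k y_def)
qed

text \<open>Started at \<open>\<sigma> k\<close>, the system meets no impulse before \<open>\<sigma> (Suc k)\<close>; there the growth condition
  reads \<open>\<parallel>S u\<parallel> \<le> g u\<close>, and \<open>u\<close> is below the maximal dwell time, where \<open>g\<close> is bounded.\<close>

lemma growth_condition_semigroup_bound:
  assumes "C0_semigroup S" "impulse_sequence \<sigma>" "growth_condition S J \<sigma>"
  obtains G where "G \<ge> 1"
    "\<And>k u. 0 \<le> u \<Longrightarrow> u < \<sigma> (Suc k) - \<sigma> k \<Longrightarrow> norm (S u) \<le> G"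
proof -
  obtain g \<mu> where growth: "\<forall>s\<ge>0. \<forall>t\<ge>s. \<forall>x.
        norm (blinfun_apply (propagator S J \<sigma> t s) x)
          \<le> g (t - s) * \<mu> ^ impulse_count \<sigma> t s * norm x"
      and fin: "(SUP \<tau>\<in>{\<tau>. 0 \<le> \<tau> \<and> ereal \<tau> < max_dwell_time \<sigma>}. ereal (g \<tau>)) < \<infinity>"
    using assms(3) unfolding growth_condition_def
    by (elim exE conjE) (rule that; assumption)
  obtain G :: real where "(SUP \<tau>\<in>{\<tau>. 0 \<le> \<tau> \<and> ereal \<tau> < max_dwell_time \<sigma>}. ereal (g \<tau>)) < G"
    using ereal_dense2[OF fin] by blast
  then have G: "g u \<le> G" if "0 \<le> u" "ereal u < max_dwell_time \<sigma>" for u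
    using SUP_lessD[of "\<lambda>\<tau>. ereal (g \<tau>)", where i=u] that by force
  have "norm (S u) \<le> max 1 G" if u: "0 \<le> u" "u < \<sigma> (Suc k) - \<sigma> k" for k u
  proof (rule norm_blinfun_bound)
    fix x
    have nn: "0 \<le> \<sigma> k" using assms(2) by (rule impulse_sequence_nonneg)
    have "ereal u < ereal (\<sigma> (Suc k) - \<sigma> k)" using u by simp
    also have "\<dots> \<le> max_dwell_time \<sigma>"
      unfolding max_dwell_time_def by (rule SUP_upper) simp
    finally have "g u \<le> G" using u by (intro G)
    have "norm (blinfun_apply (S u) x) \<le> g u * norm x"
      using growth[rule_format, of "\<sigma> k" "\<sigma> k + u" x] propagator_between_impulses[OF assms(2), of k "\<sigma> k" "\<sigma> k + u" S J]
        impulse_count_eq[OF assms(2) nn, of "\<sigma> k + u"] impulse_index_eqI[OF assms(2), of k "\<sigma> k + u"]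
        impulse_index_impulse_time[OF assms(2), of k] u nn
      by simp
    also have "\<dots> \<le> max 1 G * norm x"
      using \<open>g u \<le> G\<close> by (intro mult_right_mono) auto
    finally show "norm (blinfun_apply (S u) x) \<le> max 1 G * norm x" .
  qed simp
  then show ?thesis by (intro that[of "max 1 G"]) auto
qed

section \<open>Exponential decay with respect to a clock\<close>

text \<open>The form of Datko's argument common to both clocks. The hypothesis \<open>weighted\<close> forces
  \<open>\<parallel>U t s\<parallel> \<le> 1/2\<close> once \<open>\<phi>\<close> has advanced by a certain \<open>T\<close>. The hypothesis \<open>reach\<close> lets an interval be
  cut where \<open>\<phi>\<close> has advanced by at least \<open>T\<close> but not more than \<open>T + 1\<close>, so that the number of halvings is
  proportional to the total advance; the slack \<open>1\<close> admits clocks that jump.\<close>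

lemma exponential_decay_in_clock:
  fixes U :: "real \<Rightarrow> real \<Rightarrow> 'a::real_normed_vector \<Rightarrow>\<^sub>L 'a" and \<phi> :: "real \<Rightarrow> real"
  assumes compose: "\<And>s r t. 0 \<le> s \<Longrightarrow> s \<le> r \<Longrightarrow> r \<le> t \<Longrightarrow> U t s = U t r o\<^sub>L U r s"
    and bound: "\<And>s t. 0 \<le> s \<Longrightarrow> s \<le> t \<Longrightarrow> norm (U t s) \<le> C"
    and pos: "C > 0" "B > 0" "p > 0"
    and weighted: "\<And>s t x. 0 \<le> s \<Longrightarrow> s \<le> t \<Longrightarrow>
      (\<phi> t - \<phi> s) * (norm (blinfun_apply (U t s) x) / C) powr p \<le> (B * norm x) powr p"
    and reach: "\<And>s t T. 0 \<le> s \<Longrightarrow> s \<le> t \<Longrightarrow> 0 \<le> T \<Longrightarrow> T \<le> \<phi> t - \<phi> s \<Longrightarrow>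
      \<exists>r\<in>{s..t}. T \<le> \<phi> r - \<phi> s \<and> \<phi> r - \<phi> s \<le> T + 1"
  shows "\<exists>M>0. \<exists>\<alpha>>0. \<forall>s\<ge>0. \<forall>t\<ge>s. norm (U t s) \<le> M * exp (- \<alpha> * (\<phi> t - \<phi> s))"
proof -
  \<comment> \<open>Solves \<open>T (n / C)\<^sup>p = (2 B n)\<^sup>p\<close>, so that \<open>weighted\<close> becomes \<open>2 B n \<le> B \<parallel>x\<parallel>\<close>.\<close>
  define T where "T = (2 * C * B) powr p"
  have "T > 0" using pos by (simp add: T_def)
  have half: "norm (U t s) \<le> 1 / 2" if st: "0 \<le> s" "s \<le> t" "T \<le> \<phi> t - \<phi> s" for s t
  proof (rule norm_blinfun_bound)
    fix x
    let ?n = "norm (blinfun_apply (U t s) x)"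
    have "2 * B * ?n = (2 * C * B) * (?n / C)" using \<open>C > 0\<close> by simp
    then have "(2 * B * ?n) powr p = T * (?n / C) powr p"
      by (simp only: T_def powr_mult)
    also have "\<dots> \<le> (\<phi> t - \<phi> s) * (?n / C) powr p"
      using st by (intro mult_right_mono) auto
    also have "\<dots> \<le> (B * norm x) powr p"
      using st by (intro weighted)
    finally have "2 * B * ?n \<le> B * norm x"
      using pos powr_less_mono2[of p "B * norm x" "2 * B * ?n"] by force
    then show "?n \<le> 1 / 2 * norm x" using \<open>B > 0\<close> by simp
  qed simp
  have steps: "norm (U t s) \<le> C / 2 ^ n"
    if "0 \<le> s" "s \<le> t" "real n * (T + 1) \<le> \<phi> t - \<phi> s" for s t n
    using that
  proof (induction n arbitrary: s)
    case 0
    then show ?case by (simp add: bound)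
  next
    case (Suc n)
    have "0 \<le> real n * (T + 1)" using \<open>T > 0\<close> by simp
    then have "T \<le> \<phi> t - \<phi> s" using Suc.prems by (simp add: algebra_simps)
    then obtain r where r: "s \<le> r" "r \<le> t" "T \<le> \<phi> r - \<phi> s" "\<phi> r - \<phi> s \<le> T + 1"
      using reach[of s t T] Suc.prems \<open>T > 0\<close> by auto
    have "real n * (T + 1) \<le> \<phi> t - \<phi> r"
      using Suc.prems r by (simp add: algebra_simps)
    then have "norm (U t r) \<le> C / 2 ^ n"
      using Suc.IH[of r] Suc.prems r by simp
    then have "norm (U t r) * norm (U r s) \<le> C / 2 ^ n * (1 / 2)"
      using half[of s r] Suc.prems r pos by (intro mult_mono) auto
    moreover have "norm (U t s) \<le> norm (U t r) * norm (U r s)"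
      using compose[of s r t] Suc.prems r norm_blinfun_compose[of "U t r" "U r s"] by simp
    ultimately show ?case by simp
  qed
  define \<alpha> where "\<alpha> = ln 2 / (T + 1)"
  have "norm (U t s) \<le> 2 * C * exp (- \<alpha> * (\<phi> t - \<phi> s))" if st: "0 \<le> s" "s \<le> t" for s t
  proof -
    let ?d = "(\<phi> t - \<phi> s) / (T + 1)"
    define n where "n = nat \<lfloor>?d\<rfloor>"
    \<comment> \<open>The factor \<open>2\<close> in the constant pays for rounding \<open>?d\<close> down to \<open>n\<close>.\<close>
    have upper: "?d \<le> real n + 1" unfolding n_def by linarith
    have "norm (U t s) \<le> C / 2 ^ n"
    proof (cases "?d \<ge> 0")
      case True
      then have "real n \<le> ?d" unfolding n_def by linarith
      then show ?thesis
        using steps[OF st, of n] \<open>T > 0\<close> by (simp add: pos_le_divide_eq)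
    next
      case False
      then have "n = 0" unfolding n_def by linarith
      then show ?thesis using bound[OF st] by simp
    qed
    also have "\<dots> = 2 * C * exp (- (ln 2 * (real n + 1)))"
    proof -
      have "exp (ln 2 * (real n + 1)) = (2::real) ^ Suc n"
        using exp_of_nat2_mult[of "ln (2::real)" "Suc n"] by (simp add: add.commute)
      then have "exp (- (ln 2 * (real n + 1))) = 1 / (2 * 2 ^ n)"
        by (simp only: exp_minus inverse_eq_divide power_Suc)
      then show ?thesis by simp
    qed
    also have "\<dots> \<le> 2 * C * exp (- \<alpha> * (\<phi> t - \<phi> s))"
    proof -
      have "\<alpha> * (\<phi> t - \<phi> s) = ln 2 * ?d" by (simp add: \<alpha>_def)
      also have "\<dots> \<le> ln 2 * (real n + 1)" using upper by (intro mult_left_mono) auto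
      finally show ?thesis using \<open>C > 0\<close> by simp
    qed
    finally show ?thesis .
  qed
  moreover have "\<alpha> > 0" using \<open>T > 0\<close> by (simp add: \<alpha>_def)
  ultimately show ?thesis using \<open>C > 0\<close> by (metis mult_pos_pos zero_less_numeral)
qed

section \<open>Exponential stability of the impulsive system\<close>

theorem lemma3p4:
  fixes D :: "'a::banach set" and A :: "'a \<Rightarrow> 'a"
    and S :: "real \<Rightarrow> 'a \<Rightarrow>\<^sub>L 'a" and J :: "'a \<Rightarrow>\<^sub>L 'a"
    and \<sigma> :: "nat \<Rightarrow> real" and p b :: real
  assumes "generates_C0 D A S"
    and "J \<noteq> 0" and "blinfun_apply J ` D \<subseteq> D"
    and "impulse_sequence \<sigma>"
    and "growth_condition S J \<sigma>"
    and "p \<ge> 1" and "b > 0"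
    and "\<And>s x. s \<ge> 0 \<Longrightarrow>
      (\<integral>\<^sup>+ t\<in>{s..}. ennreal (norm (blinfun_apply (propagator S J \<sigma> t s) x) powr p) \<partial>lborel)
      + (\<Sum>\<^sub>\<infinity>k\<in>{k. 1 \<le> k \<and> s < \<sigma> k}. ennreal (norm (propagator_left S J \<sigma> (\<sigma> k) s x) powr p))
      \<le> ennreal (b powr p * norm x powr p)"
  shows "\<exists>M \<alpha> \<rho> :: real. M \<ge> 1 \<and> \<alpha> > 0 \<and> 0 < \<rho> \<and> \<rho> < 1 \<and>
      (\<forall>s\<ge>0. \<forall>t\<ge>s. \<forall>x.
         norm (blinfun_apply (propagator S J \<sigma> t s) x)
           \<le> M * exp (- \<alpha> * (t - s)) * \<rho> ^ impulse_count \<sigma> t s * norm x)"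
proof -
  let ?U = "propagator S J \<sigma>" and ?W = "\<lambda>k. propagator_left S J \<sigma> (\<sigma> k)"
    and ?i = "impulse_index \<sigma>"
  have S: "C0_semigroup S" using assms(1) by (simp add: generates_C0_def)
  note \<sigma> = \<open>impulse_sequence \<sigma>\<close>
  obtain G where "G \<ge> 1"
    and G: "\<And>k u. 0 \<le> u \<Longrightarrow> u < \<sigma> (Suc k) - \<sigma> k \<Longrightarrow> norm (S u) \<le> G"
    using growth_condition_semigroup_bound[OF S \<sigma> assms(5)] by blast
  note compose = propagator_compose[OF S \<sigma>, of _ _ _ J]
  note jump = propagator_impulse_eq_jump_of_left_limit[OF S \<sigma> _ _ G, where J=J]
  have integral_bound:
    "(\<integral>\<^sup>+ t\<in>{s..}. ennreal (norm (blinfun_apply (?U t s) x) powr p) \<partial>lborel)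
      \<le> ennreal ((b * norm x) powr p)" if "0 \<le> s" for s x
    using order_trans[OF add_increasing2[OF _ order_refl] assms(8)[OF that, of x]] \<open>b > 0\<close>
    by (simp add: powr_mult)
  have sum_bound: "(\<Sum>k\<in>F. norm (?W k s x) powr p) \<le> (b * norm x) powr p"
    if "0 \<le> s" "finite F" "F \<subseteq> {k. 1 \<le> k \<and> s < \<sigma> k}" for s x F
  proof -
    have "ennreal (\<Sum>k\<in>F. norm (?W k s x) powr p) = (\<Sum>k\<in>F. ennreal (norm (?W k s x) powr p))"
      by (rule sum_ennreal[symmetric]) simp
    also have "\<dots> \<le> (\<Sum>\<^sub>\<infinity>k\<in>{k. 1 \<le> k \<and> s < \<sigma> k}. ennreal (norm (?W k s x) powr p))"
      using that by (subst nonneg_infsum_complete) (auto intro: SUP_upper2)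
    also have "\<dots> \<le> ennreal ((b * norm x) powr p)"
      using order_trans[OF add_increasing[OF _ order_refl] assms(8)[OF that(1), of x]] \<open>b > 0\<close>
      by (simp add: powr_mult)
    finally show ?thesis by (simp add: ennreal_le_iff)
  qed
  have impulse_bound: "norm (blinfun_apply (?U (\<sigma> k) s) x) \<le> norm J * norm (?W k s x)"
    if "0 \<le> s" "s < \<sigma> k" for s x k
    using jump[OF that, where x=x] norm_blinfun[of J "?W k s x"] by simp
  have left_bound: "norm (?W k s x) \<le> b * norm x" if "0 \<le> s" "s < \<sigma> k" for s x k
  proof -
    have "1 \<le> k" using that \<sigma> by (cases k) (auto simp: impulse_sequence_def)
    then have "norm (?W k s x) powr p \<le> (b * norm x) powr p"
      using sum_bound[of s "{k}" x] that by simp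
    then show ?thesis
      using powr_less_mono2[of p "b * norm x" "norm (?W k s x)"] assms(6,7) by force
  qed
  define C where "C = G * max 1 (norm J * b)"
  have "C > 0" using \<open>G \<ge> 1\<close> by (simp add: C_def)
  have U_bound: "norm (?U t s) \<le> C" if st: "0 \<le> s" "s \<le> t" for s t
  proof (rule norm_blinfun_bound)
    fix x
    \<comment> \<open>Only the impulse-free flow from \<open>r\<close> to \<open>t\<close> is left after the last impulse in \<open>(s, t]\<close>, or
      after \<open>s\<close> if there is none.\<close>
    define r where "r = max s (\<sigma> (?i t))"
    have it: "\<sigma> (?i t) \<le> t" "t < \<sigma> (Suc (?i t))"
      using impulse_index_brackets[OF \<sigma>, of t] st by auto
    have "norm (blinfun_apply (?U r s) x) \<le> max 1 (norm J * b) * norm x"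
    proof (cases "s < \<sigma> (?i t)")
      case True
      then have "norm (blinfun_apply (?U r s) x) \<le> norm J * (b * norm x)"
        using order_trans[OF impulse_bound mult_left_mono[OF left_bound]] st by (simp add: r_def)
      also have "\<dots> \<le> max 1 (norm J * b) * norm x"
        by (simp add: mult_right_mono flip: mult.assoc)
      finally show ?thesis .
    next
      case False
      have "norm (blinfun_apply (?U s s) x) \<le> 1 * norm x"
        using propagator_between_impulses[OF \<sigma>, of "?i t" s s S J] False it st S
        by (simp add: C0_semigroup_def)
      also have "\<dots> \<le> max 1 (norm J * b) * norm x"
        by (intro mult_right_mono) auto
      finally show ?thesis using False by (simp add: r_def)
    qed
    moreover have "norm (S (t - r)) \<le> G"
      using it st by (intro G[of _ "?i t"]) (auto simp: r_def)
    moreover have "?U t s = S (t - r) o\<^sub>L ?U r s"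
      using compose[of s r t] propagator_between_impulses[OF \<sigma>, of "?i t" r t S J] it st
      by (simp add: r_def)
    ultimately show "norm (blinfun_apply (?U t s) x) \<le> C * norm x"
      using norm_blinfun[of "S (t - r)" "blinfun_apply (?U r s) x"] \<open>G \<ge> 1\<close>
        mult_mono[of "norm (S (t - r))" G "norm (blinfun_apply (?U r s) x)"
          "max 1 (norm J * b) * norm x"]
      by (simp add: C_def mult.assoc)
  qed (use \<open>C > 0\<close> in simp)
  \<comment> \<open>An orbit that is large at \<open>t\<close> cannot have been small at any earlier time.\<close>
  have past: "norm (blinfun_apply (?U t s) x) / C \<le> norm (blinfun_apply (?U r s) x)"
    if "0 \<le> s" "s \<le> r" "r \<le> t" for s r t x
  proof -
    have "norm (blinfun_apply (?U t s) x) \<le> norm (?U t r) * norm (blinfun_apply (?U r s) x)"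
      using compose[OF that] norm_blinfun[of "?U t r"] by simp
    also have "\<dots> \<le> C * norm (blinfun_apply (?U r s) x)"
      using U_bound[of r t] that by (intro mult_right_mono) auto
    finally show ?thesis using \<open>C > 0\<close> by (simp add: field_simps)
  qed
  \<comment> \<open>Decay in time, from the integral part of the hypothesis.\<close>
  have "\<exists>M>0. \<exists>\<alpha>>0. \<forall>s\<ge>0. \<forall>t\<ge>s. norm (?U t s) \<le> M * exp (- \<alpha> * (t - s))"
  proof (rule exponential_decay_in_clock[where \<phi> = "\<lambda>t. t", OF compose U_bound \<open>C > 0\<close> \<open>b > 0\<close>])
    fix s t x assume st: "0 \<le> (s::real)" "s \<le> t"
    let ?c = "(norm (blinfun_apply (?U t s) x) / C) powr p"
    have "ennreal ((t - s) * ?c) = (\<integral>\<^sup>+ u\<in>{s..t}. ennreal ?c \<partial>lborel)"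
      using st by (subst nn_integral_cmult_indicator) (auto simp: ennreal_mult' mult.commute)
    also have "\<dots> \<le> (\<integral>\<^sup>+ u\<in>{s..}. ennreal (norm (blinfun_apply (?U u s) x) powr p) \<partial>lborel)"
      using past[OF st(1)] \<open>C > 0\<close> assms(6)
      by (intro nn_integral_mono) (auto simp: indicator_def intro!: ennreal_leI powr_mono2)
    also have "\<dots> \<le> ennreal ((b * norm x) powr p)" using st by (intro integral_bound)
    finally show "(t - s) * ?c \<le> (b * norm x) powr p" by (simp add: ennreal_le_iff)
  next
    fix s t T :: real assume "0 \<le> s" "s \<le> t" "0 \<le> T" "T \<le> t - s"
    then show "\<exists>r\<in>{s..t}. T \<le> r - s \<and> r - s \<le> T + 1"
      by (intro bexI[of _ "s + T"]) auto
  qed (use assms(6) in auto)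
  then obtain M1 \<alpha> where 1: "M1 > 0" "\<alpha> > 0"
    "\<And>s t. 0 \<le> s \<Longrightarrow> s \<le> t \<Longrightarrow> norm (?U t s) \<le> M1 * exp (- \<alpha> * (t - s))" by blast
  \<comment> \<open>Decay in the number of impulses, from the sum. The factor \<open>\<parallel>J\<parallel>\<close> in \<open>B = \<parallel>J\<parallel> b\<close> is the price of
    passing from the left limits to the states just after the jumps.\<close>
  have "norm J * b > 0" using assms(2,7) by simp
  have "\<exists>M>0. \<exists>\<alpha>>0. \<forall>s\<ge>0. \<forall>t\<ge>s. norm (?U t s) \<le> M * exp (- \<alpha> * (real (?i t) - real (?i s)))"
  proof (rule exponential_decay_in_clock[where \<phi> = "\<lambda>t. real (?i t)",
        OF compose U_bound \<open>C > 0\<close> \<open>norm J * b > 0\<close>])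
    fix s t x assume st: "0 \<le> (s::real)" "s \<le> t"
    let ?c = "(norm (blinfun_apply (?U t s) x) / C) powr p"
    have in_range: "s < \<sigma> k" "\<sigma> k \<le> t" if "k \<in> {?i s<..?i t}" for k
      using that le_impulse_index_iff[OF \<sigma> st(1), of k] le_impulse_index_iff[OF \<sigma>, of t k] st
      by auto
    have summand: "?c \<le> norm J powr p * norm (?W k s x) powr p" if "k \<in> {?i s<..?i t}" for k
    proof -
      have "norm (blinfun_apply (?U t s) x) / C \<le> norm J * norm (?W k s x)"
        using order_trans[OF past impulse_bound] in_range[OF that] st by simp
      then have "?c \<le> (norm J * norm (?W k s x)) powr p"
        using \<open>C > 0\<close> assms(6) by (intro powr_mono2) auto
      then show ?thesis by (simp add: powr_mult)
    qed
    have "(real (?i t) - real (?i s)) * ?c = (\<Sum>k\<in>{?i s<..?i t}. ?c)"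
      using impulse_index_mono[OF \<sigma> st] by (simp add: of_nat_diff)
    also have "\<dots> \<le> (\<Sum>k\<in>{?i s<..?i t}. norm J powr p * norm (?W k s x) powr p)"
      using summand by (intro sum_mono)
    also have "\<dots> = norm J powr p * (\<Sum>k\<in>{?i s<..?i t}. norm (?W k s x) powr p)"
      by (simp add: sum_distrib_left)
    also have "\<dots> \<le> norm J powr p * (b * norm x) powr p"
      using st in_range by (intro mult_left_mono sum_bound) auto
    also have "\<dots> = (norm J * b * norm x) powr p"
      using \<open>b > 0\<close> by (simp add: powr_mult mult.assoc)
    finally show "(real (?i t) - real (?i s)) * ?c \<le> (norm J * b * norm x) powr p" .
  next
    fix s t T :: real assume st: "0 \<le> s" "s \<le> t" "0 \<le> T" "T \<le> real (?i t) - real (?i s)"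
    define n where "n = nat \<lceil>T\<rceil>"
    have n: "T \<le> real n" "real n \<le> T + 1" using st unfolding n_def by linarith+
    have n_le: "?i s + n \<le> ?i t" using impulse_index_mono[OF \<sigma> st(1,2)] st(4) unfolding n_def
      by (simp add: nat_le_iff ceiling_le_iff of_nat_diff le_diff_conv2[symmetric] add.commute)
    show "\<exists>r\<in>{s..t}. T \<le> real (?i r) - real (?i s) \<and> real (?i r) - real (?i s) \<le> T + 1"
    proof (cases "n = 0")
      case True
      then show ?thesis using n st by (intro bexI[of _ s]) auto
    next
      case False
      have "\<sigma> (?i s + n) \<in> {s..t}"
        using le_impulse_index_iff[OF \<sigma> st(1), of "?i s + n"] False
          le_impulse_index_iff[OF \<sigma>, of t "?i s + n"] n_le st by auto
      then show ?thesis
        using n by (intro bexI[of _ "\<sigma> (?i s + n)"]) (auto simp: impulse_index_impulse_time[OF \<sigma>])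
    qed
  qed (use assms(6) in auto)
  then obtain M2 \<beta> where 2: "M2 > 0" "\<beta> > 0"
    "\<And>s t. 0 \<le> s \<Longrightarrow> s \<le> t \<Longrightarrow> norm (?U t s) \<le> M2 * exp (- \<beta> * (real (?i t) - real (?i s)))"
    by blast
  define M where "M = max 1 (max M1 M2)"
  have "norm (blinfun_apply (?U t s) x)
      \<le> M * exp (- (\<alpha> / 2) * (t - s)) * exp (- \<beta> / 2) ^ impulse_count \<sigma> t s * norm x"
    if st: "0 \<le> s" "s \<le> t" for s t x
  proof -
    let ?u = "\<alpha> * (t - s)" and ?v = "\<beta> * (real (?i t) - real (?i s))"
    have "norm (?U t s) \<le> M * exp (- ((?u + ?v) / 2))"
    proof (cases "?u \<ge> ?v")
      case True
      have "norm (?U t s) \<le> M1 * exp (- ?u)" using 1(3)[OF st] by simp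
      also have "\<dots> \<le> M * exp (- ((?u + ?v) / 2))"
        using True 1(1) by (intro mult_mono) (auto simp: M_def)
      finally show ?thesis .
    next
      case False
      have "norm (?U t s) \<le> M2 * exp (- ?v)" using 2(3)[OF st] by simp
      also have "\<dots> \<le> M * exp (- ((?u + ?v) / 2))"
        using False 2(1) by (intro mult_mono) (auto simp: M_def)
      finally show ?thesis .
    qed
    also have "\<dots> = M * exp (- (\<alpha> / 2) * (t - s)) * exp (- \<beta> / 2) ^ impulse_count \<sigma> t s"
      using impulse_index_mono[OF \<sigma> st]
      by (simp add: impulse_count_eq[OF \<sigma> st] of_nat_diff field_simps
          flip: exp_of_nat_mult exp_add)
    finally show ?thesis
      using norm_blinfun[of "?U t s" x] mult_right_mono[of "norm (?U t s)" _ "norm x"]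
      by (meson norm_ge_zero order_trans)
  qed
  then show ?thesis
    using 1(2) 2(2)
    by (intro exI[of _ M] exI[of _ "\<alpha> / 2"] exI[of _ "exp (- \<beta> / 2)"]) (auto simp: M_def)
qed

end
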